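(* Let $1\le p<\infty$. The sequence spaces $\ell_p^{\lambda}(\widehat F)$ and $\ell_\infty^{\lambda}(\widehat F)$ are linearly isomorphic to the spaces $\ell_p$ and $\ell_\infty$, respectively, that is, $\ell_p^{\lambda}(\widehat F)\cong\ell_p$ and $\ell_\infty^{\lambda}(\widehat F)\cong\ell_\infty$.
   Context: $\mathbb N_0=\{0,1,2,\dots\}$; $\omega$ is the space of all real sequences $x=(x_k)_{k\in\mathbb N_0}$. Fibonacci numbers: $f_0=f_1=1$, $f_n=f_{n-1}+f_{n-2}$ for $n\ge 2$. $\lambda=(\lambda_k)_{k\in\mathbb N_0}$ is a fixed strictly increasing sequence of positive reals with $\lambda_k\to\infty$. Terms with negative subscript are $0$ (so $\lambda_{-1}=0$, $x_{-1}=0$). For $x\in\omega$ put $$E_n(x)=\frac1{\lambda_n}\sum_{k=0}^n(\lambda_k-\lambda_{k-1})\Big(\frac{f_k}{f_{k+1}}x_k-\frac{f_{k+1}}{f_k}x_{k-1}\Big),\qquad Ex=(E_n(x))_{n\in\mathbb N_0}.$$ Then $\ell_p^{\lambda}(\widehat F)=\{x\in\omega: Ex\in\ell_p\}$ for $1\le p<\infty$ with norm $\|x\|=\|Ex\|_p$, and $\ell_\infty^{\lambda}(\widehat F)=\{x\in\omega: Ex\in\ell_\infty\}$ with norm $\|x\|=\|Ex\|_\infty$. Two normed spaces are linearly isomorphic here in the sense that there is a linear norm-preserving bijection between them. *)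

theory Defs
  imports "HOL-Analysis.Analysis" "HOL-Number_Theory.Fib"
begin

text \<open>The library's \<open>fib\<close> starts with \<open>fib 0 = 0\<close>, \<open>fib 1 = 1\<close>; here \<open>f\<^sub>0 = f\<^sub>1 = 1\<close>.\<close>

definition fibo :: "nat \<Rightarrow> real" where
  "fibo n = real (fib (Suc n))"

lemma fibo_rec: "fibo 0 = 1" "fibo 1 = 1" "n \<ge> 2 \<Longrightarrow> fibo n = fibo (n - 1) + fibo (n - 2)"
  by (auto simp: fibo_def numeral_2_eq_2 Suc_le_eq gr0_conv_Suc dest!: less_imp_Suc_add)

text \<open>\<open>shift x k\<close> is \<open>x\<^bsub>k-1\<^esub>\<close>, with the convention that terms with negative subscript are 0.\<close>

definition shift :: "(nat \<Rightarrow> real) \<Rightarrow> nat \<Rightarrow> real" where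
  "shift x k = (case k of 0 \<Rightarrow> 0 | Suc j \<Rightarrow> x j)"

definition E_trans :: "(nat \<Rightarrow> real) \<Rightarrow> (nat \<Rightarrow> real) \<Rightarrow> nat \<Rightarrow> real" where
  "E_trans lam x n = 1 / lam n *
     (\<Sum>k=0..n. (lam k - shift lam k) *
        (fibo k / fibo (Suc k) * x k - fibo (Suc k) / fibo k * shift x k))"

definition ell :: "real \<Rightarrow> (nat \<Rightarrow> real) set" where
  "ell p = {x. summable (\<lambda>n. \<bar>x n\<bar> powr p)}"

definition ell_norm :: "real \<Rightarrow> (nat \<Rightarrow> real) \<Rightarrow> real" where
  "ell_norm p x = (\<Sum>n. \<bar>x n\<bar> powr p) powr (1 / p)"

definition ell_inf :: "(nat \<Rightarrow> real) set" where
  "ell_inf = {x. bounded (range x)}"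

definition ell_inf_norm :: "(nat \<Rightarrow> real) \<Rightarrow> real" where
  "ell_inf_norm x = (SUP n. \<bar>x n\<bar>)"

definition ell_lamF :: "(nat \<Rightarrow> real) \<Rightarrow> real \<Rightarrow> (nat \<Rightarrow> real) set" where
  "ell_lamF lam p = {x. E_trans lam x \<in> ell p}"

definition ell_lamF_norm :: "(nat \<Rightarrow> real) \<Rightarrow> real \<Rightarrow> (nat \<Rightarrow> real) \<Rightarrow> real" where
  "ell_lamF_norm lam p x = ell_norm p (E_trans lam x)"

definition ell_inf_lamF :: "(nat \<Rightarrow> real) \<Rightarrow> (nat \<Rightarrow> real) set" where
  "ell_inf_lamF lam = {x. E_trans lam x \<in> ell_inf}"

definition ell_inf_lamF_norm :: "(nat \<Rightarrow> real) \<Rightarrow> (nat \<Rightarrow> real) \<Rightarrow> real" where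
  "ell_inf_lamF_norm lam x = ell_inf_norm (E_trans lam x)"

definition lin_isomorphic ::
  "(nat \<Rightarrow> real) set \<Rightarrow> ((nat \<Rightarrow> real) \<Rightarrow> real) \<Rightarrow>
   (nat \<Rightarrow> real) set \<Rightarrow> ((nat \<Rightarrow> real) \<Rightarrow> real) \<Rightarrow> bool" where
  "lin_isomorphic X normX Y normY \<longleftrightarrow>
     (\<exists>T. bij_betw T X Y \<and>
        (\<forall>x\<in>X. \<forall>y\<in>X. T (\<lambda>k. x k + y k) = (\<lambda>k. T x k + T y k)) \<and>
        (\<forall>c. \<forall>x\<in>X. T (\<lambda>k. c * x k) = (\<lambda>k. c * T x k)) \<and>
        (\<forall>x\<in>X. normY (T x) = normX x))"

text \<open>The four carriers are linear subspaces of the space of all real sequences, so linearity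
  on the carrier, as used in \<open>lin_isomorphic\<close>, is meaningful.\<close>

lemma E_trans_add: "E_trans lam (\<lambda>k. x k + y k) = (\<lambda>n. E_trans lam x n + E_trans lam y n)"
proof
  fix n
  have s: "shift (\<lambda>k. x k + y k) k = shift x k + shift y k" for k
    by (simp add: shift_def split: nat.split)
  show "E_trans lam (\<lambda>k. x k + y k) n = E_trans lam x n + E_trans lam y n"
    unfolding E_trans_def s distrib_left[symmetric] sum.distrib[symmetric]
    by (simp add: algebra_simps add_divide_distrib diff_divide_distrib)
qed

lemma E_trans_scale: "E_trans lam (\<lambda>k. c * x k) = (\<lambda>n. c * E_trans lam x n)"
proof
  fix n
  have s: "shift (\<lambda>k. c * x k) k = c * shift x k" for k
    by (simp add: shift_def split: nat.split)
  show "E_trans lam (\<lambda>k. c * x k) n = c * E_trans lam x n"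
    unfolding E_trans_def s sum_distrib_left
    by (intro sum.cong) (auto simp: algebra_simps)
qed

lemma ell_add:
  assumes "1 \<le> p" "x \<in> ell p" "y \<in> ell p"
  shows "(\<lambda>k. x k + y k) \<in> ell p"
proof -
  have le: "\<bar>a + b\<bar> powr p \<le> 2 powr p * (\<bar>a\<bar> powr p + \<bar>b\<bar> powr p)" for a b :: real
  proof -
    have "\<bar>a + b\<bar> powr p \<le> (2 * max \<bar>a\<bar> \<bar>b\<bar>) powr p"
      using assms(1) by (intro powr_mono2) auto
    also have "\<dots> = 2 powr p * max \<bar>a\<bar> \<bar>b\<bar> powr p" by (simp add: powr_mult)
    also have "\<dots> \<le> 2 powr p * (\<bar>a\<bar> powr p + \<bar>b\<bar> powr p)"
      by (intro mult_left_mono) (auto simp: max_def)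
    finally show ?thesis .
  qed
  have "summable (\<lambda>n. 2 powr p * (\<bar>x n\<bar> powr p + \<bar>y n\<bar> powr p))"
    using assms by (intro summable_mult summable_add) (auto simp: ell_def)
  then have "summable (\<lambda>n. \<bar>x n + y n\<bar> powr p)"
    by (rule summable_comparison_test') (use le in auto)
  then show ?thesis by (simp add: ell_def)
qed

lemma ell_scale: "x \<in> ell p \<Longrightarrow> (\<lambda>k. c * x k) \<in> ell p"
  by (auto simp: ell_def abs_mult powr_mult intro: summable_mult)

lemma ell_inf_add: "x \<in> ell_inf \<Longrightarrow> y \<in> ell_inf \<Longrightarrow> (\<lambda>k. x k + y k) \<in> ell_inf"
  unfolding ell_inf_def by (simp add: bounded_plus_comp)

lemma ell_inf_scale: "x \<in> ell_inf \<Longrightarrow> (\<lambda>k. c * x k) \<in> ell_inf"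
  unfolding ell_inf_def using bounded_scaling[of "range x" c] by (simp add: image_image)

lemma ell_lamF_add:
  "1 \<le> p \<Longrightarrow> x \<in> ell_lamF lam p \<Longrightarrow> y \<in> ell_lamF lam p \<Longrightarrow> (\<lambda>k. x k + y k) \<in> ell_lamF lam p"
  by (simp add: ell_lamF_def E_trans_add ell_add)

lemma ell_lamF_scale: "x \<in> ell_lamF lam p \<Longrightarrow> (\<lambda>k. c * x k) \<in> ell_lamF lam p"
  by (simp add: ell_lamF_def E_trans_scale ell_scale)

lemma ell_inf_lamF_add:
  "x \<in> ell_inf_lamF lam \<Longrightarrow> y \<in> ell_inf_lamF lam \<Longrightarrow> (\<lambda>k. x k + y k) \<in> ell_inf_lamF lam"
  by (simp add: ell_inf_lamF_def E_trans_add ell_inf_add)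

lemma ell_inf_lamF_scale: "x \<in> ell_inf_lamF lam \<Longrightarrow> (\<lambda>k. c * x k) \<in> ell_inf_lamF lam"
  by (simp add: ell_inf_lamF_def E_trans_scale ell_inf_scale)

end

theory Submission
  imports Defs
begin

text \<open>The map \<open>x \<mapsto> E x\<close> is the isomorphism, and it preserves the norms by definition. It is
  bijective on the space of all sequences because its matrix is lower triangular with nonzero
  diagonal: multiplying by \<open>lam n\<close> and taking differences turns \<open>E x = y\<close> into a first-order linear
  recurrence for \<open>x\<close>.\<close>

lemma shift_simps [simp]: "shift x 0 = 0" "shift x (Suc n) = x n"
  by (simp_all add: shift_def)

lemma fibo_pos: "0 < fibo n"
  by (simp add: fibo_def fib_neq_0_nat)

text \<open>Telescoping. Since \<open>shift s 0 = 0\<close>, the difference at index 0 is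
  \<open>s 0\<close> itself, so no initial condition is lost in either direction.\<close>

lemma partial_sums_eq_iff:
  fixes s t :: "nat \<Rightarrow> real"
  shows "(\<forall>n. (\<Sum>k=0..n. t k) = s n) \<longleftrightarrow> (\<forall>n. t n = s n - shift s n)"
proof
  assume sums: "\<forall>n. (\<Sum>k=0..n. t k) = s n"
  have "t n = s n - shift s n" for n
    by (cases n) (simp_all flip: sums[rule_format])
  then show "\<forall>n. t n = s n - shift s n" ..
next
  assume diff: "\<forall>n. t n = s n - shift s n"
  have "(\<Sum>k=0..n. t k) = s n" for n
    by (induction n) (simp_all add: diff)
  then show "\<forall>n. (\<Sum>k=0..n. t k) = s n" ..
qed

text \<open>The convention \<open>shift x 0 = 0\<close> forces the initial value \<open>g 0\<close>,
  and every later term is determined by its predecessor.\<close>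

lemma ex1_recurrence:
  fixes g h :: "nat \<Rightarrow> real"
  shows "\<exists>!x. \<forall>n. x n = g n + h n * shift x n"
proof (rule ex_ex1I)
  define x where "x = rec_nat (g 0) (\<lambda>n r. g (Suc n) + h (Suc n) * r)"
  have "x n = g n + h n * shift x n" for n
    by (cases n) (simp_all add: x_def)
  then show "\<exists>x. \<forall>n. x n = g n + h n * shift x n" by blast
next
  fix x y
  assume x: "\<forall>n. x n = g n + h n * shift x n" and y: "\<forall>n. y n = g n + h n * shift y n"
  have "x n = y n" for n
  proof (induction n)
    case 0
    show ?case using x[rule_format, of 0] y[rule_format, of 0] by simp
  next
    case (Suc n)
    then show ?case using x[rule_format, of "Suc n"] y[rule_format, of "Suc n"] by simp
  qed
  then show "x = y" ..
qed

lemma E_trans_eq_iff: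
  assumes "strict_mono lam" and pos: "\<And>k. 0 < lam k"
  shows "E_trans lam x = y \<longleftrightarrow>
    (\<forall>n. x n = fibo (Suc n) / fibo n *
        ((lam n * y n - shift (\<lambda>k. lam k * y k) n) / (lam n - shift lam n))
      + (fibo (Suc n) / fibo n)\<^sup>2 * shift x n)"
proof -
  \<comment> \<open>At \<open>n = 0\<close> the gap is \<open>lam 0\<close>, so positivity is used
    there and strict monotonicity at successors.\<close>
  have gap: "lam n - shift lam n > 0" for n
    using assms by (cases n) (auto simp: strict_mono_Suc_iff)
  define t where "t k = (lam k - shift lam k) *
        (fibo k / fibo (Suc k) * x k - fibo (Suc k) / fibo k * shift x k)" for k
  have "E_trans lam x = y \<longleftrightarrow> (\<forall>n. (\<Sum>k=0..n. t k) = lam n * y n)"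
    using pos[THEN less_imp_neq]
    unfolding fun_eq_iff E_trans_def t_def[symmetric] by (simp add: field_simps)
  also have "\<dots> \<longleftrightarrow> (\<forall>n. t n = lam n * y n - shift (\<lambda>k. lam k * y k) n)"
    by (rule partial_sums_eq_iff)
  also have "\<dots> \<longleftrightarrow> (\<forall>n. x n = fibo (Suc n) / fibo n *
        ((lam n * y n - shift (\<lambda>k. lam k * y k) n) / (lam n - shift lam n))
      + (fibo (Suc n) / fibo n)\<^sup>2 * shift x n)"
  proof (intro all_cong1)
    \<comment> \<open>Here \<open>a\<close>, \<open>b\<close> stand for consecutive Fibonacci
      numbers and \<open>d\<close> for the gap; the square arises from dividing \<open>b / a\<close>
      by \<open>a / b\<close>.\<close>
    have solve: "d * (a / b * u - b / a * v) = w \<longleftrightarrow> u = b / a * (w / d) + (b / a)\<^sup>2 * v"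
      if "d > 0" "a > 0" "b > 0" for a b d u v w :: real
    proof -
      have "d * (a / b * u - b / a * v) = w \<longleftrightarrow> a / b * u = w / d + b / a * v"
        using that by (auto simp: field_simps)
      also have "\<dots> \<longleftrightarrow> u = b / a * (w / d + b / a * v)"
        using that by (auto simp: field_simps)
      finally show ?thesis by (simp add: algebra_simps power2_eq_square)
    qed
    show "t n = lam n * y n - shift (\<lambda>k. lam k * y k) n \<longleftrightarrow>
      x n = fibo (Suc n) / fibo n *
        ((lam n * y n - shift (\<lambda>k. lam k * y k) n) / (lam n - shift lam n))
      + (fibo (Suc n) / fibo n)\<^sup>2 * shift x n" for n
      unfolding t_def by (rule solve[OF gap fibo_pos fibo_pos])
  qed
  finally show ?thesis .
qed

lemma bij_E_trans:
  assumes "strict_mono lam" "\<And>k. 0 < lam k"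
  shows "bij (E_trans lam)"
  \<comment> \<open>Bijectivity is read as unique solvability of \<open>E_trans lam x = y\<close>
    for every \<open>y\<close>; only the inhomogeneous term of the recurrence depends on
    \<open>y\<close>.\<close>
  unfolding bij_iff E_trans_eq_iff[OF assms] by (intro allI ex1_recurrence)

text \<open>Keeping \<open>Y\<close> and \<open>N\<close> arbitrary treats finite \<open>p\<close>
  and the supremum norm at once: the domain is a preimage and its norm is pulled back along the
  map.\<close>

lemma lin_isomorphic_E_trans:
  assumes "strict_mono lam" "\<And>k. 0 < lam k"
  shows "lin_isomorphic {x. E_trans lam x \<in> Y} (\<lambda>x. N (E_trans lam x)) Y N"
proof -
  have "E_trans lam ` {x. E_trans lam x \<in> Y} = Y"
    \<comment> \<open>Surjectivity onto all sequences ensures that the image of the preimage of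
      \<open>Y\<close> is the whole of \<open>Y\<close>.\<close>
    using surj_image_vimage_eq[OF bij_is_surj[OF bij_E_trans[OF assms]]]
    by (simp add: vimage_def)
  then have "bij_betw (E_trans lam) {x. E_trans lam x \<in> Y} Y"
    by (intro bij_betw_subset[OF bij_E_trans[OF assms]]) auto
  then show ?thesis
    unfolding lin_isomorphic_def
    by (intro exI[of _ "E_trans lam"]) (simp add: E_trans_add E_trans_scale)
qed

theorem theorem2p3:
  fixes lam :: "nat \<Rightarrow> real" and p :: real
  assumes "strict_mono lam"
    and "\<And>k. 0 < lam k"
    and "filterlim lam at_top sequentially"
    and "1 \<le> p"
  shows "lin_isomorphic (ell_lamF lam p) (ell_lamF_norm lam p) (ell p) (ell_norm p) \<and>
    lin_isomorphic (ell_inf_lamF lam) (ell_inf_lamF_norm lam) ell_inf ell_inf_norm"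
  unfolding ell_lamF_def ell_inf_lamF_def ell_lamF_norm_def[abs_def] ell_inf_lamF_norm_def[abs_def]
  by (intro conjI lin_isomorphic_E_trans assms(1,2))

end
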